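(* Let $\Sigma$ be a finite alphabet and let $W\in\Sigma^\infty$ be a computable infinite word such that every word in $\Sigma^*$ is a factor of $W$. Then the prefix realizability problem $\mathrm{R}_p(W)$ is decidable.
   Context: An infinite word over $\Sigma$ is a sequence $W=w_1w_2\ldots w_n\ldots$ of symbols of $\Sigma$; it is computable if $n\mapsto w_n$ is computable. A factor of $W$ is a finite word of the form $w_nw_{n+1}\ldots w_m$ (the empty word is also regarded as a factor). $\mathrm{Pref}(W)\subseteq\Sigma^*$ is the set of all finite prefixes $w_1\ldots w_n$ of $W$. The prefix realizability problem $\mathrm{R}_p(W)$: given a regular language $R\subseteq\Sigma^*$ (described by a deterministic finite automaton recognizing it), decide whether $R\cap\mathrm{Pref}(W)\neq\varnothing$. *)

theory Defs
  imports "HOL-Library.Cardinality" "HOL-Library.Nat_Bijection" "HOL-Library.Omega_Words_Fun"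
begin

text \<open>
  The general recursive functions of arity \<open>n\<close>, with minimisation restricted to regular
  (everywhere defined) searches, so that all functions are total. A function of arity \<open>n\<close> is
  represented on argument lists; its values on lists of any other length are irrelevant.
\<close>

inductive recursive_fn :: "nat \<Rightarrow> (nat list \<Rightarrow> nat) \<Rightarrow> bool" where
  zero: "recursive_fn n (\<lambda>xs. 0)"
| succ: "recursive_fn 1 (\<lambda>xs. Suc (xs ! 0))"
| proj: "i < n \<Longrightarrow> recursive_fn n (\<lambda>xs. xs ! i)"
| comp: "\<lbrakk>recursive_fn (length gs) f; \<forall>g\<in>set gs. recursive_fn n g\<rbrakk>
    \<Longrightarrow> recursive_fn n (\<lambda>xs. f (map (\<lambda>g. g xs) gs))"
| prec: "\<lbrakk>recursive_fn n f; recursive_fn (Suc (Suc n)) g\<rbrakk>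
    \<Longrightarrow> recursive_fn (Suc n)
          (\<lambda>xs. rec_nat (f (tl xs)) (\<lambda>y r. g (y # r # tl xs)) (hd xs))"
| mini: "\<lbrakk>recursive_fn (Suc n) f; \<forall>xs. length xs = n \<longrightarrow> (\<exists>y. f (y # xs) = 0)\<rbrakk>
    \<Longrightarrow> recursive_fn n (\<lambda>xs. LEAST y. f (y # xs) = 0)"

definition computable :: "(nat \<Rightarrow> nat) \<Rightarrow> bool" where
  "computable f \<longleftrightarrow> (\<exists>F. recursive_fn 1 F \<and> (\<forall>x. F [x] = f x))"

definition decidable :: "nat set \<Rightarrow> bool" where
  "decidable S \<longleftrightarrow> computable (\<lambda>x. if x \<in> S then 1 else 0)"


text \<open>A numbering of the finite alphabet, through which symbols become machine data.\<close>

definition numbering :: "('a::finite \<Rightarrow> nat) \<Rightarrow> bool" where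
  "numbering c \<longleftrightarrow> bij_betw c UNIV {..<CARD('a)}"

definition computable_word :: "('a::finite \<Rightarrow> nat) \<Rightarrow> 'a word \<Rightarrow> bool" where
  "computable_word c W \<longleftrightarrow> computable (\<lambda>n. c (W n))"

text \<open>Words are indexed from \<open>0\<close>; \<open>W [i \<rightarrow> j]\<close> excludes position \<open>j\<close>, so it is empty if \<open>j \<le> i\<close>.\<close>

definition is_factor :: "'a list \<Rightarrow> 'a word \<Rightarrow> bool" where
  "is_factor u W \<longleftrightarrow> (\<exists>i j. u = W [i \<rightarrow> j])"

definition Pref :: "'a word \<Rightarrow> 'a list set" where
  "Pref W = {prefix n W | n. True}"


text \<open>Complete deterministic finite automata with state set \<open>{..<num_states A}\<close>.\<close>

record 'a dfa =
  num_states :: nat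
  start :: nat
  step :: "nat \<Rightarrow> 'a \<Rightarrow> nat"
  accepting :: "nat set"

definition is_dfa :: "'a dfa \<Rightarrow> bool" where
  "is_dfa A \<longleftrightarrow>
     start A < num_states A \<and>
     (\<forall>q<num_states A. \<forall>a. step A q a < num_states A) \<and>
     accepting A \<subseteq> {..<num_states A}"

definition lang :: "'a dfa \<Rightarrow> 'a list set" where
  "lang A = {u. foldl (step A) (start A) u \<in> accepting A}"

text \<open>
  The code lists the number of states, the start state, the transition table (one row per state,
  one column per symbol number) and the characteristic vector of the accepting states. Values of
  \<open>step A\<close> outside the state set do not enter it.
\<close>

definition dfa_code :: "('a::finite \<Rightarrow> nat) \<Rightarrow> 'a dfa \<Rightarrow> nat" where
  "dfa_code c A = list_encode
     [num_states A,
      start A,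
      list_encode (map (\<lambda>q. list_encode (map (\<lambda>i. step A q (inv c i)) [0..<CARD('a)]))
                       [0..<num_states A]),
      list_encode (map (\<lambda>q. if q \<in> accepting A then 1 else 0) [0..<num_states A])]"

text \<open>The prefix realizability problem, as its set of positive instances.\<close>

definition Rp :: "'a word \<Rightarrow> 'a dfa set" where
  "Rp W = {A. is_dfa A \<and> lang A \<inter> Pref W \<noteq> {}}"

end

theory Submission imports Defs begin

text \<open>
  Run the automaton on \<open>W\<close> until the run has met an accepting state or has reached a state from
  which no accepting state is reachable. One of the two happens: concatenating words one state
  after the other gives a word \<open>u\<close> that leads every state through an accepting state or into a
  dead one, and \<open>u\<close> occurs somewhere in \<open>W\<close>. Deadness of a state is certified by a set of
  non-accepting states that is closed under transitions, so the search ranges over pairs of a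
  length and a coded set of states.
\<close>

section \<open>Closure properties of the recursive functions\<close>

text \<open>Each constructor of \<open>recursive_fn\<close> also fixes values on lists of the wrong
  length. These are forgotten here, so a function may be replaced by any other that agrees with it
  on lists of length \<open>n\<close>.\<close>

definition recf :: "nat \<Rightarrow> (nat list \<Rightarrow> nat) \<Rightarrow> bool" where
  "recf n f \<longleftrightarrow> (\<exists>F. recursive_fn n F \<and> (\<forall>xs. length xs = n \<longrightarrow> F xs = f xs))"

definition recp :: "nat \<Rightarrow> (nat list \<Rightarrow> bool) \<Rightarrow> bool" where
  "recp n P \<longleftrightarrow> recf n (\<lambda>xs. if P xs then 1 else 0)"

lemma recfI: "recursive_fn n F \<Longrightarrow> (\<And>xs. length xs = n \<Longrightarrow> F xs = f xs) \<Longrightarrow> recf n f"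
  unfolding recf_def by blast

lemma recf_cong: "recf n f \<Longrightarrow> (\<And>xs. length xs = n \<Longrightarrow> f xs = g xs) \<Longrightarrow> recf n g"
  unfolding recf_def by metis

lemma computable_iff_recf: "computable f \<longleftrightarrow> recf 1 (\<lambda>xs. f (hd xs))"
  unfolding computable_def recf_def by (auto simp: length_Suc_conv)

section \<open>Composition and handling of variables\<close>

lemma recf_comp:
  assumes "recf (length gs) f" and "\<forall>g\<in>set gs. recf n g"
  shows "recf n (\<lambda>xs. f (map (\<lambda>g. g xs) gs))"
proof -
  obtain F where F: "recursive_fn (length gs) F" "\<And>xs. length xs = length gs \<Longrightarrow> F xs = f xs"
    using assms(1) unfolding recf_def by blast
  obtain h where h: "\<forall>g\<in>set gs. recursive_fn n (h g) \<and> (\<forall>xs. length xs = n \<longrightarrow> h g xs = g xs)"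
    using bchoice[OF assms(2)[unfolded recf_def]] by blast
  have "recursive_fn n (\<lambda>xs. F (map (\<lambda>g. g xs) (map h gs)))"
    using F(1) h by (intro recursive_fn.comp) auto
  then show ?thesis
  proof (rule recfI)
    fix xs :: "nat list" assume "length xs = n"
    then have "map (\<lambda>g. g xs) (map h gs) = map (\<lambda>g. g xs) gs" using h by simp
    then show "F (map (\<lambda>g. g xs) (map h gs)) = f (map (\<lambda>g. g xs) gs)"
      by (simp add: F(2) del: map_map)
  qed
qed

lemma recf_nth: "i < n \<Longrightarrow> recf n (\<lambda>xs. xs ! i)"
  by (rule recfI[OF recursive_fn.proj]) auto

text \<open>Weakening: composition with projections makes a function of the outer arguments usable
  under one more binder.\<close>

lemma recf_tl:
  assumes "recf n f"
  shows "recf (Suc n) (\<lambda>xs. f (tl xs))"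
proof -
  let ?gs = "map (\<lambda>i xs. xs ! Suc i) [0..<n]"
  have "recf (Suc n) (\<lambda>xs. f (map (\<lambda>g. g xs) ?gs))"
    using assms by (intro recf_comp) (auto intro: recf_nth)
  then show ?thesis
  proof (rule recf_cong)
    fix xs :: "nat list" assume "length xs = Suc n"
    then have "map (\<lambda>g. g xs) ?gs = tl xs"
      by (auto simp: list_eq_iff_nth_eq nth_tl)
    then show "f (map (\<lambda>g. g xs) ?gs) = f (tl xs)" by simp
  qed
qed

lemma recf_subst:
  assumes "recf (Suc n) f" and "recf n h"
  shows "recf n (\<lambda>xs. f (h xs # xs))"
proof -
  let ?gs = "h # map (\<lambda>i xs. xs ! i) [0..<n]"
  have "recf n (\<lambda>xs. f (map (\<lambda>g. g xs) ?gs))"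
    using assms by (intro recf_comp) (auto intro: recf_nth)
  then show ?thesis
  proof (rule recf_cong)
    fix xs :: "nat list" assume "length xs = n"
    then have "map (\<lambda>g. g xs) ?gs = h xs # xs"
      by (auto simp: list_eq_iff_nth_eq nth_Cons split: nat.split)
    then show "f (map (\<lambda>g. g xs) ?gs) = f (h xs # xs)" by simp
  qed
qed

text \<open>Needed for recursion bodies, which receive a counter and the previous value, when a
  function of the counter alone is to be used in them.\<close>

lemma recf_skip:
  assumes "recf (Suc n) f"
  shows "recf (Suc (Suc n)) (\<lambda>xs. f (hd xs # tl (tl xs)))"
proof -
  let ?gs = "(\<lambda>xs. xs ! 0) # map (\<lambda>i xs. xs ! Suc (Suc i)) [0..<n]"
  have "recf (Suc (Suc n)) (\<lambda>xs. f (map (\<lambda>g. g xs) ?gs))"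
    using assms by (intro recf_comp) (auto intro: recf_nth)
  then show ?thesis
  proof (rule recf_cong)
    fix xs :: "nat list" assume "length xs = Suc (Suc n)"
    then obtain a b ys where "xs = a # b # ys" "length ys = n"
      by (auto simp: length_Suc_conv)
    then have "map (\<lambda>g. g xs) ?gs = hd xs # tl (tl xs)"
      by (auto intro: nth_equalityI)
    then show "f (map (\<lambda>g. g xs) ?gs) = f (hd xs # tl (tl xs))" by simp
  qed
qed

lemma recf_hd: "recf (Suc n) hd"
  by (rule recf_cong[OF recf_nth[of 0]]) (auto simp: length_Suc_conv)

lemma recf_hd_tl: "recf (Suc (Suc n)) (\<lambda>xs. hd (tl xs))"
  by (intro recf_tl recf_hd)

lemma recf_hd_tl_tl: "recf (Suc (Suc (Suc n))) (\<lambda>xs. hd (tl (tl xs)))"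
  using recf_tl[OF recf_hd_tl] .

lemma recf_hd_tl_tl_tl: "recf (Suc (Suc (Suc (Suc n)))) (\<lambda>xs. hd (tl (tl (tl xs))))"
  using recf_tl[OF recf_hd_tl_tl] .

lemmas recf_vars = recf_hd recf_hd_tl recf_hd_tl_tl recf_hd_tl_tl_tl

text \<open>
  An argument list is an environment of de Bruijn indices: a binder pushes its value on the front,
  so that under \<open>k\<close> binders a function \<open>f\<close> of the outer arguments reads \<open>f (tl (\<dots> (tl zs)))\<close>.
\<close>

lemma recf_rec:
  assumes "recf n f" and "recf n h"
    and "recf (Suc (Suc n)) (\<lambda>zs. g (hd zs) (hd (tl zs)) (tl (tl zs)))"
  shows "recf n (\<lambda>xs. rec_nat (f xs) (\<lambda>y r. g y r xs) (h xs))"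
proof -
  obtain F where F: "recursive_fn n F" "\<And>xs. length xs = n \<Longrightarrow> F xs = f xs"
    using assms(1) unfolding recf_def by blast
  obtain G where G: "recursive_fn (Suc (Suc n)) G"
    "\<And>zs. length zs = Suc (Suc n) \<Longrightarrow> G zs = g (hd zs) (hd (tl zs)) (tl (tl zs))"
    using assms(3) unfolding recf_def by blast
  \<comment> \<open>The rule \<open>prec\<close> recurses on the head of the argument list;
    substitution then puts \<open>h xs\<close> there.\<close>
  have "recf (Suc n) (\<lambda>xs. rec_nat (f (tl xs)) (\<lambda>y r. g y r (tl xs)) (hd xs))"
    by (rule recfI[OF recursive_fn.prec[OF F(1) G(1)]]) (simp add: F(2) G(2))
  from recf_subst[OF this assms(2)] show ?thesis by simp
qed

lemma recf_zero: "recf n (\<lambda>xs. 0)"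
  by (rule recfI[OF recursive_fn.zero]) simp

lemma recf_Suc: "recf n f \<Longrightarrow> recf n (\<lambda>xs. Suc (f xs))"
  using recf_comp[of "[f]" "\<lambda>xs. Suc (xs ! 0)" n] recfI[OF recursive_fn.succ] by simp

lemma recf_const: "recf n (\<lambda>xs. k)"
  by (induction k) (auto intro: recf_zero recf_Suc)

lemma recf_computable:
  assumes "computable w" and "recf n f"
  shows "recf n (\<lambda>xs. w (f xs))"
  using recf_comp[of "[f]" "\<lambda>xs. w (hd xs)" n] assms by (simp add: computable_iff_recf)

section \<open>Arithmetic and case distinction\<close>

lemma recf_add:
  assumes "recf n f" and "recf n g"
  shows "recf n (\<lambda>xs. f xs + g xs)"
proof -
  have "rec_nat a (\<lambda>_ r. Suc r) b = a + b" for a b :: nat by (induction b) auto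
  moreover have "recf n (\<lambda>xs. rec_nat (f xs) (\<lambda>_ r. Suc r) (g xs))"
    by (intro recf_rec assms recf_Suc recf_vars)
  ultimately show ?thesis by simp
qed

lemma recf_diff:
  assumes "recf n f" and "recf n g"
  shows "recf n (\<lambda>xs. f xs - g xs)"
proof -
  \<comment> \<open>The predecessor is the recursion that returns its own counter; iterating it
    \<open>b\<close> times is truncated subtraction.\<close>
  have pred: "rec_nat 0 (\<lambda>y _. y) a = a - 1" for a :: nat by (cases a) auto
  have "rec_nat a (\<lambda>_ r. rec_nat 0 (\<lambda>y _. y) r) b = a - b" for a b :: nat
    by (induction b) (simp_all add: pred)
  moreover have "recf n (\<lambda>xs. rec_nat (f xs) (\<lambda>_ r. rec_nat 0 (\<lambda>y _. y) r) (g xs))"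
    by (intro recf_rec assms recf_zero recf_vars)
  ultimately show ?thesis by simp
qed

lemma recf_if:
  assumes "recp n P" and "recf n f" and "recf n g"
  shows "recf n (\<lambda>xs. if P xs then f xs else g xs)"
proof -
  \<comment> \<open>The recursion takes no step or exactly one, so it yields \<open>g xs\<close> or
    \<open>f xs\<close>.\<close>
  have "recf n (\<lambda>xs. rec_nat (g xs) (\<lambda>_ _. f xs) (if P xs then 1 else 0))"
    using assms unfolding recp_def by (intro recf_rec recf_tl[OF recf_tl[OF assms(2)]])
  then show ?thesis by (rule recf_cong) simp
qed

section \<open>Decidable predicates, bounded quantifiers and search\<close>

lemma recp_cong: "recp n P \<Longrightarrow> (\<And>xs. length xs = n \<Longrightarrow> P xs = Q xs) \<Longrightarrow> recp n Q"
  unfolding recp_def by (erule recf_cong) simp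

lemma recp_conj:
  assumes "recp n P" and "recp n Q"
  shows "recp n (\<lambda>xs. P xs \<and> Q xs)"
proof -
  have "recf n (\<lambda>xs. if P xs then if Q xs then 1 else 0 else 0)"
    by (intro recf_if assms recf_const)
  then show ?thesis unfolding recp_def by (rule recf_cong) simp
qed

lemma recp_not:
  assumes "recp n P"
  shows "recp n (\<lambda>xs. \<not> P xs)"
proof -
  have "recf n (\<lambda>xs. if P xs then 0 else 1)"
    by (intro recf_if assms recf_const)
  then show ?thesis unfolding recp_def by (rule recf_cong) simp
qed

lemma recp_disj: "recp n P \<Longrightarrow> recp n Q \<Longrightarrow> recp n (\<lambda>xs. P xs \<or> Q xs)"
  using recp_not[OF recp_conj[OF recp_not recp_not]] by simp

lemma recp_imp: "recp n P \<Longrightarrow> recp n Q \<Longrightarrow> recp n (\<lambda>xs. P xs \<longrightarrow> Q xs)"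
  unfolding imp_conv_disj by (intro recp_disj recp_not)

lemma recp_less:
  assumes "recf n f" and "recf n g"
  shows "recp n (\<lambda>xs. f xs < g xs)"
proof -
  \<comment> \<open>The difference \<open>b - a\<close> is positive exactly when
    \<open>a < b\<close>, and a recursion of at least one step returns 1.\<close>
  have "rec_nat 0 (\<lambda>_ _. 1) (b - a) = (if a < b then 1 else 0 :: nat)" for a b :: nat
    by (cases "b - a") auto
  moreover have "recf n (\<lambda>xs. rec_nat 0 (\<lambda>_ _. 1) (g xs - f xs))"
    by (intro recf_rec recf_diff assms recf_const)
  ultimately show ?thesis unfolding recp_def by (simp only:)
qed

lemma recp_eq:
  assumes "recf n f" and "recf n g"
  shows "recp n (\<lambda>xs. f xs = g xs)"
proof -
  have "recp n (\<lambda>xs. \<not> f xs < g xs \<and> \<not> g xs < f xs)"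
    by (intro recp_conj recp_not recp_less assms)
  then show ?thesis by (rule recp_cong) auto
qed

lemma recp_bex:
  assumes "recf n b" and "recp (Suc n) (\<lambda>zs. P (hd zs) (tl zs))"
  shows "recp n (\<lambda>xs. \<exists>y<b xs. P y xs)"
proof -
  have "rec_nat 0 (\<lambda>y r. if P y xs then 1 else r) m = (if \<exists>y<m. P y xs then 1 else 0 :: nat)" for m xs
    by (induction m) (auto simp: less_Suc_eq)
  \<comment> \<open>Inside the recursion the accumulator stands between the counter and the outer
    arguments, so \<open>P\<close> has to skip it.\<close>
  moreover have "recp (Suc (Suc n)) (\<lambda>zs. P (hd zs) (tl (tl zs)))"
    using recf_skip[OF assms(2)[unfolded recp_def]] by (simp add: recp_def)
  then have "recf n (\<lambda>xs. rec_nat 0 (\<lambda>y r. if P y xs then 1 else r) (b xs))"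
    by (intro recf_rec assms(1) recf_if recf_const recf_vars)
  ultimately show ?thesis unfolding recp_def by simp
qed

lemma recp_ball:
  assumes "recf n b" and "recp (Suc n) (\<lambda>zs. P (hd zs) (tl zs))"
  shows "recp n (\<lambda>xs. \<forall>y<b xs. P y xs)"
proof -
  have "recp n (\<lambda>xs. \<not> (\<exists>y<b xs. \<not> P y xs))"
    by (intro recp_not recp_bex assms)
  then show ?thesis by simp
qed

lemma recf_Least:
  assumes "recp (Suc n) (\<lambda>zs. P (hd zs) (tl zs))"
    and "\<And>xs. length xs = n \<Longrightarrow> \<exists>y. P y xs"
  shows "recf n (\<lambda>xs. LEAST y. P y xs)"
proof -
  \<comment> \<open>Minimisation looks for a zero, hence the characteristic function of the
    negation. The second assumption is the regularity that \<open>mini\<close> demands.\<close>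
  obtain F where F: "recursive_fn (Suc n) F"
    "\<And>zs. length zs = Suc n \<Longrightarrow> F zs = (if \<not> P (hd zs) (tl zs) then 1 else 0)"
    using recp_not[OF assms(1)] unfolding recp_def recf_def by blast
  have "recursive_fn n (\<lambda>xs. LEAST y. F (y # xs) = 0)"
    using F(1) by (rule recursive_fn.mini) (simp add: F(2) assms(2))
  then show ?thesis by (rule recfI) (simp add: F(2))
qed


section \<open>Computing with list codes\<close>

text \<open>\<open>list_encode (a # l)\<close> is
  \<open>Suc (prod_encode (a, list_encode l))\<close>, so a predecessor precedes the unpairing. On
  0, the code of the empty list, head and tail are both 0.\<close>

definition code_hd :: "nat \<Rightarrow> nat" where
  "code_hd x = fst (prod_decode (x - 1))"

definition code_tl :: "nat \<Rightarrow> nat" where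
  "code_tl x = snd (prod_decode (x - 1))"

definition code_drop :: "nat \<Rightarrow> nat \<Rightarrow> nat" where
  "code_drop i x = rec_nat x (\<lambda>_. code_tl) i"

definition code_nth :: "nat \<Rightarrow> nat \<Rightarrow> nat" where
  "code_nth x i = code_hd (code_drop i x)"

text \<open>Only the empty list has code 0, so the length is the number of tails taken until 0
  appears; in this form it is a regular search.\<close>

definition code_length :: "nat \<Rightarrow> nat" where
  "code_length x = (LEAST k. code_drop k x = 0)"

lemma code_hd_encode: "l \<noteq> [] \<Longrightarrow> code_hd (list_encode l) = hd l"
  by (cases l) (simp_all add: code_hd_def)

lemma code_tl_encode: "code_tl (list_encode l) = list_encode (tl l)"
proof (cases l)
  case Nil
  then show ?thesis using prod_encode_inverse[of "(0, 0)"]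
    by (simp add: code_tl_def prod_encode_def)
qed (simp add: code_tl_def)

lemma code_drop_encode: "code_drop i (list_encode l) = list_encode (drop i l)"
  by (induction i) (simp_all add: code_drop_def code_tl_encode drop_Suc tl_drop)

lemma list_encode_eq_0_iff: "list_encode l = 0 \<longleftrightarrow> l = []"
  by (cases l) simp_all

lemma code_nth_encode: "i < length l \<Longrightarrow> code_nth (list_encode l) i = l ! i"
  by (simp add: code_nth_def code_drop_encode code_hd_encode hd_drop_conv_nth)

lemma code_length_encode: "code_length (list_encode l) = length l"
  unfolding code_length_def code_drop_encode list_encode_eq_0_iff
  by (rule Least_equality) auto

text \<open>Every number codes a list, so a number is determined by its length and entries as a
  code. This serves to recognise codes of automata.\<close>

lemma list_encode_code: "list_encode (map (code_nth x) [0..<code_length x]) = x"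
proof -
  obtain l where x: "x = list_encode l" using list_decode_inverse[of x] by metis
  have "map (code_nth x) [0..<code_length x] = l"
    by (auto simp: x code_length_encode code_nth_encode intro: nth_equalityI)
  then show ?thesis by (simp add: x)
qed

section \<open>Recursiveness of pairing and of the list operations\<close>

lemma recf_triangle:
  assumes "recf n f"
  shows "recf n (\<lambda>xs. triangle (f xs))"
proof -
  have "rec_nat 0 (\<lambda>y r. r + Suc y) k = triangle k" for k by (induction k) auto
  moreover have "recf n (\<lambda>xs. rec_nat 0 (\<lambda>y r. r + Suc y) (f xs))"
    by (intro recf_rec recf_add recf_Suc recf_const recf_vars assms)
  ultimately show ?thesis by simp
qed

lemma recf_prod_encode: "recf n f \<Longrightarrow> recf n g \<Longrightarrow> recf n (\<lambda>xs. prod_encode (f xs, g xs))"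
  unfolding prod_encode_def by (simp add: recf_add recf_triangle)

text \<open>The pairing is inverted by search. A component never exceeds the code of its pair, so
  the other component ranges over a bounded set.\<close>

lemma recf_fst_prod_decode:
  assumes "recf n f"
  shows "recf n (\<lambda>xs. fst (prod_decode (f xs)))"
proof -
  have ex: "\<exists>k<Suc x. prod_encode (fst (prod_decode x), k) = x" for x
    by (rule exI[of _ "snd (prod_decode x)"])
      (metis le_imp_less_Suc le_prod_encode_2 prod.collapse prod_decode_inverse)
  have "(LEAST m. \<exists>k<Suc x. prod_encode (m, k) = x) = fst (prod_decode x)" for x
    by (rule Least_equality) (use ex in auto)
  moreover have "recf n (\<lambda>xs. LEAST m. \<exists>k<Suc (f xs). prod_encode (m, k) = f xs)"
    by (intro recf_Least recp_bex recp_eq recf_prod_encode recf_Suc recf_vars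
        recf_tl[OF recf_tl[OF assms]] recf_tl[OF assms]) (use ex in blast)
  ultimately show ?thesis by simp
qed

lemma recf_snd_prod_decode:
  assumes "recf n f"
  shows "recf n (\<lambda>xs. snd (prod_decode (f xs)))"
proof -
  have eq: "prod_encode (fst (prod_decode x), k) = x \<longleftrightarrow> k = snd (prod_decode x)" for x k
    by (metis prod.collapse prod_decode_inverse prod_encode_inverse snd_conv)
  have "recf n (\<lambda>xs. LEAST k. prod_encode (fst (prod_decode (f xs)), k) = f xs)"
    by (intro recf_Least recp_eq recf_prod_encode recf_fst_prod_decode recf_vars
        recf_tl[OF assms]) (simp add: eq)
  moreover have "(LEAST k. k = a) = a" for a :: nat by (rule Least_equality) auto
  ultimately show ?thesis by (simp add: eq)
qed

lemma recf_code_hd: "recf n f \<Longrightarrow> recf n (\<lambda>xs. code_hd (f xs))"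
  unfolding code_hd_def by (intro recf_fst_prod_decode recf_diff recf_const)

lemma recf_code_tl: "recf n f \<Longrightarrow> recf n (\<lambda>xs. code_tl (f xs))"
  unfolding code_tl_def by (intro recf_snd_prod_decode recf_diff recf_const)

lemma recf_code_drop: "recf n f \<Longrightarrow> recf n g \<Longrightarrow> recf n (\<lambda>xs. code_drop (f xs) (g xs))"
  unfolding code_drop_def by (intro recf_rec recf_code_tl recf_vars)

lemma recf_code_nth: "recf n f \<Longrightarrow> recf n g \<Longrightarrow> recf n (\<lambda>xs. code_nth (f xs) (g xs))"
  unfolding code_nth_def by (intro recf_code_hd recf_code_drop)

lemma recf_code_length:
  assumes "recf n f"
  shows "recf n (\<lambda>xs. code_length (f xs))"
proof -
  \<comment> \<open>The search is total: dropping as many entries as the decoded list has leaves the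
    empty list.\<close>
  have "\<exists>k. code_drop k x = 0" for x
    using code_drop_encode[of "length (list_decode x)" "list_decode x"] by auto
  then show ?thesis unfolding code_length_def
    by (intro recf_Least recp_eq recf_code_drop recf_const recf_vars recf_tl[OF assms])
qed

lemmas rec_intros =
  recp_conj recp_disj recp_not recp_imp recp_less recp_eq recp_bex recp_ball
  recf_code_hd recf_code_tl recf_code_nth recf_code_length
  recf_vars recf_Suc recf_const


section \<open>Runs on words that contain every factor\<close>

lemma foldl_subsequence:
  "i \<le> j \<Longrightarrow> foldl \<delta> (foldl \<delta> q (prefix i W)) (W [i \<rightarrow> j]) = foldl \<delta> q (prefix j W)"
  by (metis foldl_append le0 le_add_diff_inverse map_append subsequence_def upt_add_eq_append)

definition dead :: "('q \<Rightarrow> 'a \<Rightarrow> 'q) \<Rightarrow> 'q set \<Rightarrow> 'q \<Rightarrow> bool" where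
  "dead \<delta> F q \<longleftrightarrow> (\<forall>u. foldl \<delta> q u \<notin> F)"

lemma dead_foldl: "dead \<delta> F q \<Longrightarrow> dead \<delta> F (foldl \<delta> q u)"
  unfolding dead_def by (metis foldl_append)

text \<open>By induction on \<open>Q\<close>: if \<open>q\<close> is not yet dead after
  \<open>u\<close>, append a \<open>v\<close> that leads it on into \<open>F\<close>. States already
  treated stay resolved, since a visit to \<open>F\<close> within \<open>u\<close> persists and
  deadness is preserved by further letters.\<close>

lemma uniform_resolving_word:
  assumes "finite Q"
  shows "\<exists>u. \<forall>q\<in>Q. (\<exists>k\<le>length u. foldl \<delta> q (take k u) \<in> F) \<or> dead \<delta> F (foldl \<delta> q u)"
  using assms
proof (induction Q)
  case empty
  then show ?case by simp
next
  case (insert q Q)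
  define res where
    "res u q \<longleftrightarrow> (\<exists>k\<le>length u. foldl \<delta> q (take k u) \<in> F) \<or> dead \<delta> F (foldl \<delta> q u)" for u q
  obtain u where u: "\<forall>q\<in>Q. res u q" using insert.IH unfolding res_def by blast
  have "\<exists>u. \<forall>q\<in>insert q Q. res u q"
  proof (cases "dead \<delta> F (foldl \<delta> q u)")
    case True
    then have "res u q" unfolding res_def by blast
    then show ?thesis using u by blast
  next
    case False
    then obtain v where v: "foldl \<delta> q (u @ v) \<in> F" by (auto simp: dead_def)
    have "res (u @ v) p" if "res u p" for p
      using that unfolding res_def
    proof
      assume "\<exists>k\<le>length u. foldl \<delta> p (take k u) \<in> F"
      then obtain k where "k \<le> length u" "foldl \<delta> p (take k u) \<in> F" by blast
      then have "k \<le> length (u @ v)" "foldl \<delta> p (take k (u @ v)) \<in> F" by simp_all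
      then show "(\<exists>k\<le>length (u @ v). foldl \<delta> p (take k (u @ v)) \<in> F) \<or>
          dead \<delta> F (foldl \<delta> p (u @ v))" by blast
    next
      assume "dead \<delta> F (foldl \<delta> p u)"
      then show "(\<exists>k\<le>length (u @ v). foldl \<delta> p (take k (u @ v)) \<in> F) \<or>
          dead \<delta> F (foldl \<delta> p (u @ v))" by (simp add: dead_foldl)
    qed
    moreover have "res (u @ v) q"
      using v unfolding res_def by (intro disjI1 exI[of _ "length (u @ v)"]) simp
    ultimately show ?thesis using u by blast
  qed
  then show ?case unfolding res_def .
qed

text \<open>Wherever an occurrence of the resolving word begins in \<open>W\<close>, the run is in
  some state of \<open>Q\<close>; reading that word then meets \<open>F\<close> or ends in a dead
  state.\<close>

lemma run_accepts_or_dies: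
  assumes "\<forall>u. is_factor u W" and "finite Q" and "\<And>m. foldl \<delta> q\<^sub>0 (prefix m W) \<in> Q"
  shows "\<exists>m. foldl \<delta> q\<^sub>0 (prefix m W) \<in> F \<or> dead \<delta> F (foldl \<delta> q\<^sub>0 (prefix m W))"
proof -
  obtain u where u: "\<forall>q\<in>Q. (\<exists>k\<le>length u. foldl \<delta> q (take k u) \<in> F) \<or> dead \<delta> F (foldl \<delta> q u)"
    using uniform_resolving_word[OF assms(2)] by blast
  obtain i j where "u = (W [i \<rightarrow> j])" using assms(1) unfolding is_factor_def by blast
  \<comment> \<open>The end index is normalised, as an empty factor may be given by any
    \<open>j \<le> i\<close>.\<close>
  then have u_eq: "u = (W [i \<rightarrow> i + length u])"
    by (cases "i \<le> j") (auto simp: subsequence_def)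
  have run: "foldl \<delta> (foldl \<delta> q\<^sub>0 (prefix i W)) (take k u) = foldl \<delta> q\<^sub>0 (prefix (i + k) W)"
    if "k \<le> length u" for k
  proof -
    have "take k u = (W [i \<rightarrow> i + k])"
      by (subst u_eq) (use that in \<open>simp add: subsequence_def take_map take_upt\<close>)
    then show ?thesis by (simp add: foldl_subsequence)
  qed
  from u assms(3)[of i] run run[of "length u"] show ?thesis by (metis order_refl take_all)
qed


section \<open>The decision procedure on codes\<close>

text \<open>Entries 0 to 3 of an automaton code are the number of states, the start state, the
  transition table and the acceptance vector.\<close>

definition code_step :: "nat \<Rightarrow> nat \<Rightarrow> nat \<Rightarrow> nat" where
  "code_step x q i = code_nth (code_nth (code_nth x 2) q) i"

definition code_acc :: "nat \<Rightarrow> nat \<Rightarrow> bool" where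
  "code_acc x q \<longleftrightarrow> \<not> code_nth (code_nth x 3) q = 0"

definition code_run :: "(nat \<Rightarrow> nat) \<Rightarrow> nat \<Rightarrow> nat \<Rightarrow> nat" where
  "code_run w x m = rec_nat (code_nth x 1) (\<lambda>k r. code_step x r (w k)) m"

text \<open>\<open>K\<close> stands for the alphabet size. All lengths are prescribed and the
  acceptance entries are 0 or 1, so that nothing but codes of automata passes.\<close>

definition code_valid :: "nat \<Rightarrow> nat \<Rightarrow> bool" where
  "code_valid K x \<longleftrightarrow>
     code_length x = 4 \<and> code_nth x 1 < code_nth x 0 \<and>
     code_length (code_nth x 2) = code_nth x 0 \<and>
     (\<forall>q<code_nth x 0. code_length (code_nth (code_nth x 2) q) = K \<and>
       (\<forall>i<K. code_step x q i < code_nth x 0)) \<and>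
     code_length (code_nth x 3) = code_nth x 0 \<and>
     (\<forall>q<code_nth x 0. code_nth (code_nth x 3) q < 2)"

definition code_accepted :: "(nat \<Rightarrow> nat) \<Rightarrow> nat \<Rightarrow> nat \<Rightarrow> bool" where
  "code_accepted w x m \<longleftrightarrow> (\<exists>k<Suc m. code_acc x (code_run w x k))"

text \<open>\<open>b\<close> is read as the characteristic vector of a set of non-accepting states
  closed under transitions. Unlike deadness, which quantifies over all words, this is checked by
  bounded quantifiers.\<close>

definition code_trap :: "nat \<Rightarrow> nat \<Rightarrow> nat \<Rightarrow> bool" where
  "code_trap K x b \<longleftrightarrow>
     (\<forall>p<code_nth x 0. \<not> code_nth b p = 0 \<longrightarrow>
       \<not> code_acc x p \<and> (\<forall>i<K. \<not> code_nth b (code_step x p i) = 0))"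

text \<open>One number \<open>y\<close> carries both search variables: its head is the length of
  prefix read, its tail the trap. Invalid codes halt at once because minimisation requires a search
  that succeeds on every input.\<close>

definition code_halts :: "nat \<Rightarrow> (nat \<Rightarrow> nat) \<Rightarrow> nat \<Rightarrow> nat \<Rightarrow> bool" where
  "code_halts K w x y \<longleftrightarrow>
     \<not> code_valid K x \<or> code_accepted w x (code_hd y) \<or>
     (\<not> code_nth (code_tl y) (code_run w x (code_hd y)) = 0 \<and> code_trap K x (code_tl y))"

section \<open>Recursiveness of the search and its ingredients\<close>

lemma recf_code_step:
  "recf n f \<Longrightarrow> recf n g \<Longrightarrow> recf n h \<Longrightarrow> recf n (\<lambda>xs. code_step (f xs) (g xs) (h xs))"
  unfolding code_step_def by (intro rec_intros)

lemma recp_code_acc: "recf n f \<Longrightarrow> recf n g \<Longrightarrow> recp n (\<lambda>xs. code_acc (f xs) (g xs))"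
  unfolding code_acc_def by (intro rec_intros)

lemma recf_code_run:
  assumes "computable w" and "recf n f" and "recf n g"
  shows "recf n (\<lambda>xs. code_run w (f xs) (g xs))"
  unfolding code_run_def
  by (intro recf_rec recf_code_step recf_computable[OF assms(1)] rec_intros assms
      recf_tl[OF recf_tl[OF assms(2)]])

lemma recp_code_valid:
  assumes "recf n f"
  shows "recp n (\<lambda>xs. code_valid K (f xs))"
  unfolding code_valid_def
  by (intro recf_code_step rec_intros assms recf_tl[OF assms] recf_tl[OF recf_tl[OF assms]])

lemma recp_code_accepted:
  assumes "computable w" and "recf n f" and "recf n g"
  shows "recp n (\<lambda>xs. code_accepted w (f xs) (g xs))"
  unfolding code_accepted_def
  by (intro recp_code_acc recf_code_run rec_intros assms recf_tl[OF assms(2)])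

lemma recp_code_trap:
  assumes "recf n f" and "recf n g"
  shows "recp n (\<lambda>xs. code_trap K (f xs) (g xs))"
  unfolding code_trap_def
  by (intro recp_code_acc recf_code_step rec_intros assms recf_tl[OF assms(1)] recf_tl[OF assms(2)]
      recf_tl[OF recf_tl[OF assms(1)]] recf_tl[OF recf_tl[OF assms(2)]])

lemma recp_code_halts:
  assumes "computable w" and "recf n f" and "recf n g"
  shows "recp n (\<lambda>xs. code_halts K w (f xs) (g xs))"
  unfolding code_halts_def
  by (intro recp_code_valid recp_code_accepted recp_code_trap recf_code_run rec_intros assms)

lemma decidable_code_search:
  assumes "computable w" and "\<And>x. \<exists>y. code_halts K w x y"
  shows "decidable {x. code_valid K x \<and>
    code_accepted w x (code_hd (LEAST y. code_halts K w x y))}"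
proof -
  have "recp 1 (\<lambda>xs. code_valid K (hd xs) \<and>
      code_accepted w (hd xs) (code_hd (LEAST y. code_halts K w (hd xs) y)))"
    unfolding One_nat_def
    by (intro recp_code_valid recp_code_accepted recp_code_halts recf_Least rec_intros assms)
  then show ?thesis unfolding decidable_def computable_iff_recf recp_def by simp
qed

section \<open>Automata and their codes\<close>

context
  fixes c :: "'a::finite \<Rightarrow> nat"
  assumes c: "numbering c"
begin

lemma numbering_inv: "inv c (c a) = a"
  using c unfolding numbering_def by (simp add: bij_betw_imp_inj_on inv_f_f)

lemma numbering_less: "c a < CARD('a)"
  using c unfolding numbering_def by (auto dest: bij_betwE)

lemma numbering_f_inv: "i < CARD('a) \<Longrightarrow> c (inv c i) = i"
  using c unfolding numbering_def bij_betw_def by (intro f_inv_into_f) auto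

lemma code_nth_dfa_code:
  "code_nth (dfa_code c A) 0 = num_states A"
  "code_nth (dfa_code c A) (Suc 0) = start A"
  "code_nth (dfa_code c A) 2 = list_encode
     (map (\<lambda>q. list_encode (map (\<lambda>i. step A q (inv c i)) [0..<CARD('a)])) [0..<num_states A])"
  "code_nth (dfa_code c A) 3 =
     list_encode (map (\<lambda>q. if q \<in> accepting A then 1 else 0) [0..<num_states A])"
  unfolding dfa_code_def by (simp_all add: code_nth_encode del: list_encode.simps)

lemma code_step_dfa_code:
  "q < num_states A \<Longrightarrow> i < CARD('a) \<Longrightarrow> code_step (dfa_code c A) q i = step A q (inv c i)"
  by (simp add: code_step_def code_nth_dfa_code code_nth_encode)

lemma code_acc_dfa_code: "q < num_states A \<Longrightarrow> code_acc (dfa_code c A) q \<longleftrightarrow> q \<in> accepting A"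
  by (simp add: code_acc_def code_nth_dfa_code code_nth_encode)

text \<open>An automaton can be read off the table and vector of a valid code; encoding it again
  restores the number, since list codes are determined by length and entries.\<close>

lemma code_valid_iff: "code_valid CARD('a) x \<longleftrightarrow> (\<exists>A. is_dfa A \<and> x = dfa_code c A)"
proof
  assume v: "code_valid CARD('a) x"
  let ?n = "code_nth x 0"
  define A where "A = \<lparr>num_states = ?n, start = code_nth x 1,
    step = (\<lambda>q a. code_step x q (c a)), accepting = {q. q < ?n \<and> code_acc x q}\<rparr>"
  have "is_dfa A"
    using v by (auto simp: is_dfa_def A_def code_valid_def numbering_less)
  moreover have "x = dfa_code c A"
  proof -
    have n: "num_states A = ?n" by (simp add: A_def)
    have row: "list_encode (map (\<lambda>i. step A q (inv c i)) [0..<CARD('a)]) =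
        code_nth (code_nth x 2) q" if "q < ?n" for q
    proof -
      have "map (\<lambda>i. step A q (inv c i)) [0..<CARD('a)] =
          map (code_nth (code_nth (code_nth x 2) q)) [0..<code_length (code_nth (code_nth x 2) q)]"
        using v that by (simp add: code_valid_def A_def numbering_f_inv code_step_def)
      then show ?thesis by (simp add: list_encode_code)
    qed
    have "map (\<lambda>q. list_encode (map (\<lambda>i. step A q (inv c i)) [0..<CARD('a)])) [0..<num_states A] =
        map (code_nth (code_nth x 2)) [0..<code_length (code_nth x 2)]"
      using v by (simp add: row code_valid_def n)
    then have table: "list_encode (map (\<lambda>q. list_encode (map (\<lambda>i. step A q (inv c i)) [0..<CARD('a)]))
        [0..<num_states A]) = code_nth x 2"
      by (simp only: list_encode_code)
    \<comment> \<open>Entries are below 2, so a nonzero entry is 1 and rewriting the vector with 0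
      and 1 changes nothing.\<close>
    have "map (\<lambda>q. if q \<in> accepting A then 1 else 0) [0..<num_states A] =
        map (code_nth (code_nth x 3)) [0..<code_length (code_nth x 3)]"
      using v by (auto simp: code_valid_def A_def code_acc_def less_2_cases_iff)
    then have final: "list_encode (map (\<lambda>q. if q \<in> accepting A then 1 else 0) [0..<num_states A]) =
        code_nth x 3"
      by (simp only: list_encode_code)
    have "[0..<4] = [0, 1, 2, 3::nat]" by (simp add: upt_rec)
    then have "list_encode [code_nth x 0, code_nth x 1, code_nth x 2, code_nth x 3] = x"
      using list_encode_code[of x] v by (simp add: code_valid_def)
    then show ?thesis
      unfolding dfa_code_def table final by (simp add: A_def)
  qed
  ultimately show "\<exists>A. is_dfa A \<and> x = dfa_code c A" by blast
next
  assume "\<exists>A. is_dfa A \<and> x = dfa_code c A"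
  then obtain A where A: "is_dfa A" and x: "x = dfa_code c A" by blast
  have "code_length x = 4" by (simp add: x dfa_code_def code_length_encode del: list_encode.simps)
  then show "code_valid CARD('a) x"
    using A unfolding code_valid_def x
    by (simp add: code_step_dfa_code is_dfa_def code_nth_dfa_code code_length_encode code_nth_encode)
qed

context
  fixes A :: "'a dfa"
  assumes A: "is_dfa A"
begin

lemma foldl_step_less: "q < num_states A \<Longrightarrow> foldl (step A) q u < num_states A"
  using A by (induction u arbitrary: q) (auto simp: is_dfa_def)

lemma run_less: "foldl (step A) (start A) u < num_states A"
  using A by (intro foldl_step_less) (simp add: is_dfa_def)

lemma code_run_dfa_code:
  "code_run (\<lambda>n. c (W n)) (dfa_code c A) m = foldl (step A) (start A) (prefix m W)"
proof (induction m)
  case 0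
  then show ?case by (simp add: code_run_def code_nth_dfa_code)
next
  case (Suc m)
  then have "code_run (\<lambda>n. c (W n)) (dfa_code c A) (Suc m) =
      code_step (dfa_code c A) (foldl (step A) (start A) (prefix m W)) (c (W m))"
    by (simp add: code_run_def)
  also have "\<dots> = step A (foldl (step A) (start A) (prefix m W)) (W m)"
    by (simp add: code_step_dfa_code run_less numbering_less numbering_inv)
  finally show ?case by (simp add: subsequence_def)
qed

lemma code_accepted_dfa_code:
  "code_accepted (\<lambda>n. c (W n)) (dfa_code c A) m \<longleftrightarrow> (\<exists>k\<le>m. prefix k W \<in> lang A)"
  by (simp add: code_accepted_def code_run_dfa_code code_acc_dfa_code run_less lang_def less_Suc_eq_le)

text \<open>Soundness of the certificate: by induction on the word, closure keeps the run inside the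
  trap, where no state is accepting.\<close>

lemma code_trap_dead:
  assumes "code_trap CARD('a) (dfa_code c A) b" and "p < num_states A" and "code_nth b p \<noteq> 0"
  shows "dead (step A) (accepting A) p"
proof -
  have "foldl (step A) p u \<notin> accepting A" for u
    using assms(2,3)
  proof (induction u arbitrary: p)
    case Nil
    then show ?case using assms(1) by (simp add: code_trap_def code_nth_dfa_code code_acc_dfa_code)
  next
    case (Cons a u)
    have "code_nth b (code_step (dfa_code c A) p (c a)) \<noteq> 0"
      using assms(1) Cons.prems numbering_less by (simp add: code_trap_def code_nth_dfa_code)
    then have "code_nth b (step A p a) \<noteq> 0"
      using Cons.prems by (simp add: code_step_dfa_code numbering_less numbering_inv)
    then show ?case
      using Cons foldl_step_less[of p "[a]"] by simp
  qed
  then show ?thesis by (simp add: dead_def)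
qed

text \<open>Completeness of the certificate: the set of all dead states is itself a trap, being
  closed under transitions and, by the empty word, free of accepting states. Its code need only
  exist for the search to end.\<close>

lemma ex_code_trap:
  "\<exists>b. code_trap CARD('a) (dfa_code c A) b \<and>
     (\<forall>p<num_states A. dead (step A) (accepting A) p \<longrightarrow> code_nth b p \<noteq> 0)"
proof -
  let ?D = "dead (step A) (accepting A)"
  define b where "b = list_encode (map (\<lambda>p. if ?D p then 1 else 0) [0..<num_states A])"
  have b: "code_nth b p \<noteq> 0 \<longleftrightarrow> ?D p" if "p < num_states A" for p
    using that by (simp add: b_def code_nth_encode)
  have closed: "?D p \<Longrightarrow> ?D (step A p a)" for p a
    using dead_foldl[of "step A" _ p "[a]"] by simp
  have final: "?D p \<Longrightarrow> p \<notin> accepting A" for p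
    unfolding dead_def by (metis foldl_Nil)
  have "step A p a < num_states A" if "p < num_states A" for p a
    using foldl_step_less[OF that, of "[a]"] by simp
  then have "code_trap CARD('a) (dfa_code c A) b"
    using b closed final
    by (simp add: code_trap_def code_nth_dfa_code code_acc_dfa_code code_step_dfa_code)
  then show ?thesis using b by blast
qed

end

text \<open>Totality of the search, the one place where the assumption that every word is a factor
  of \<open>W\<close> enters the argument about codes.\<close>

lemma ex_code_halts:
  assumes "\<forall>u. is_factor u W"
  shows "\<exists>y. code_halts CARD('a) (\<lambda>n. c (W n)) x y"
proof (cases "code_valid CARD('a) x")
  case True
  then obtain A where A: "is_dfa A" and x: "x = dfa_code c A"
    using code_valid_iff by blast
  let ?run = "\<lambda>m. foldl (step A) (start A) (prefix m W)"
  obtain b where b: "code_trap CARD('a) x b"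
    "\<And>p. p < num_states A \<Longrightarrow> dead (step A) (accepting A) p \<Longrightarrow> code_nth b p \<noteq> 0"
    using ex_code_trap[OF A] unfolding x by blast
  obtain m where m: "?run m \<in> accepting A \<or> dead (step A) (accepting A) (?run m)"
    using run_accepts_or_dies[OF assms, of "{..<num_states A}" "step A" "start A" "accepting A"]
      run_less[OF A] by auto
  \<comment> \<open>The successor makes \<open>y\<close> a nonempty list code with head
    \<open>m\<close> and tail \<open>b\<close>.\<close>
  define y where "y = Suc (prod_encode (m, b))"
  have y: "code_hd y = m" "code_tl y = b" by (simp_all add: y_def code_hd_def code_tl_def)
  have "code_accepted (\<lambda>n. c (W n)) x m" if "?run m \<in> accepting A"
    using that unfolding x code_accepted_dfa_code[OF A] lang_def by blast
  moreover have "code_nth b (code_run (\<lambda>n. c (W n)) x m) \<noteq> 0"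
    if "dead (step A) (accepting A) (?run m)"
    using that b(2) run_less[OF A] unfolding x code_run_dfa_code[OF A] by blast
  ultimately have "code_halts CARD('a) (\<lambda>n. c (W n)) x y"
    using m b(1) unfolding code_halts_def y by blast
  then show ?thesis ..
qed (simp add: code_halts_def)

text \<open>Every halting \<open>y\<close> gives the right answer, hence so does the least: if no
  accepting state was met, the trap shows the state reached to be dead, so no longer prefix is
  accepted.\<close>

lemma code_halts_accepted_iff:
  assumes A: "is_dfa A" and "code_halts CARD('a) (\<lambda>n. c (W n)) (dfa_code c A) y"
  shows "code_accepted (\<lambda>n. c (W n)) (dfa_code c A) (code_hd y) \<longleftrightarrow> lang A \<inter> Pref W \<noteq> {}"
proof
  assume "code_accepted (\<lambda>n. c (W n)) (dfa_code c A) (code_hd y)"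
  then show "lang A \<inter> Pref W \<noteq> {}"
    unfolding code_accepted_dfa_code[OF A] Pref_def by blast
next
  let ?run = "\<lambda>m. foldl (step A) (start A) (prefix m W)"
  assume "lang A \<inter> Pref W \<noteq> {}"
  then obtain k where k: "prefix k W \<in> lang A" unfolding Pref_def by blast
  show "code_accepted (\<lambda>n. c (W n)) (dfa_code c A) (code_hd y)"
  proof (rule ccontr)
    assume na: "\<not> ?thesis"
    have "code_valid CARD('a) (dfa_code c A)" using A code_valid_iff by blast
    then have "code_trap CARD('a) (dfa_code c A) (code_tl y)"
      "code_nth (code_tl y) (?run (code_hd y)) \<noteq> 0"
      using assms(2) na unfolding code_halts_def code_run_dfa_code[OF A] by blast+
    then have dead: "dead (step A) (accepting A) (?run (code_hd y))"
      using code_trap_dead[OF A] run_less[OF A] by blast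
    \<comment> \<open>An accepted prefix of smaller length would already have been noticed; so the
      run on \<open>prefix k W\<close> passes through the dead state.\<close>
    have "code_hd y \<le> k"
      using na k unfolding code_accepted_dfa_code[OF A] by (meson nat_le_linear)
    from foldl_subsequence[OF this, of "step A" "start A" W] dead k
    show False unfolding dead_def lang_def by (metis mem_Collect_eq)
  qed
qed

end

theorem theorem2:
  fixes c :: "'a::finite \<Rightarrow> nat" and W :: "'a word"
  assumes "numbering c"
    and "computable_word c W"
    and "\<forall>u :: 'a list. is_factor u W"
  shows "decidable (dfa_code c ` Rp W)"
proof -
  let ?w = "\<lambda>n. c (W n)"
  let ?y = "\<lambda>x. LEAST y. code_halts CARD('a) ?w x y"
  have halts: "\<exists>y. code_halts CARD('a) ?w x y" for x
    using ex_code_halts[OF assms(1,3)] .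
  have accepted: "code_accepted ?w (dfa_code c A) (code_hd (?y (dfa_code c A))) \<longleftrightarrow>
      lang A \<inter> Pref W \<noteq> {}" if "is_dfa A" for A
    using code_halts_accepted_iff[OF assms(1) that LeastI_ex[OF halts]] .
  \<comment> \<open>Both inclusions apply \<open>accepted\<close> to an automaton with code
    \<open>x\<close>; from right to left, validity supplies it.\<close>
  have "dfa_code c ` Rp W = {x. code_valid CARD('a) x \<and> code_accepted ?w x (code_hd (?y x))}"
    using accepted unfolding code_valid_iff[OF assms(1)] Rp_def by fast
  moreover have "computable ?w"
    using assms(2) unfolding computable_word_def .
  ultimately show ?thesis
    using decidable_code_search[OF _ halts] by simp
qed

end
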